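(* Let $(a,F)$ be a game and let $\rho$ be its associated measure on $(0,\infty)$. If $\int_0^\infty \rho(dt)<\infty$, then $\lim_{m\to E^-}\dfrac{u_{\max}(m)}{E-m}=\dfrac12$.
   Context: A game is a pair $(a,F)$, where $F$ is a probability distribution function on an interval $I\subseteq\mathbb{R}$ (so $\int_I dF=1$) and $a:I\to\mathbb{R}$ is measurable and not constant $F$-almost everywhere. Put $E=\int_I a(x)\,dF$, $\xi=\operatorname{ess\,inf}_{x\in I}a(x)$ (with respect to $F$), and $H_\xi=\int_I \frac{1}{a(x)-\xi}\,dF\in(0,\infty]$, where $H_\xi=\infty$ if $\int_{a(x)=\xi}dF>0$, and $1/H_\xi=0$ if $H_\xi=\infty$. Standing assumptions: $E>0$ ($E=+\infty$ allowed) and $\xi>-\infty$. One has $\xi+1/H_\xi<E$. Define $\Psi(c)=1/\int_I (a(x)+c)^{-1}dF-c$ for $c>-\xi$. For $m\in(\xi+1/H_\xi,E)$ and $0<u<E-m$, the optimal proportion of investment at price $u$ for the translated game $(a-m,F)$ is the unique $t=t_u^{(m)}\in(0,u/(u+m-\xi))$ with $\int_I \frac{a(x)-m-u}{(a(x)-m)t-tu+u}\,dF=0$. Then $u_{\max}(m)$ denotes the unique number in $(0,E-m)$ such that $u\mapsto t_u^{(m)}$ is strictly increasing on $(0,u_{\max}(m))$ and strictly decreasing on $(u_{\max}(m),E-m)$. The measure $\rho$ associated with the game is the unique measure on $(0,\infty)$ with $\int_0^\infty\frac{1}{t(t+1)}\rho(dt)<\infty$ and $\Psi(c)=\xi+\frac1{H_\xi}+\int_0^\infty\frac{c+\xi}{t(t+c+\xi)}\rho(dt)$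 for all $c>-\xi$. *)

theory Defs
  imports "HOL-Probability.Probability"
begin

definition distribution_function :: "(real \<Rightarrow> real) \<Rightarrow> bool" where
  "distribution_function F \<longleftrightarrow>
     mono F \<and> (\<forall>x. continuous (at_right x) F) \<and>
     (F \<longlongrightarrow> 0) at_bot \<and> (F \<longlongrightarrow> 1) at_top"

text \<open>The Lebesgue--Stieltjes measure \<open>dF\<close> on \<open>I\<close>. It is completed, so that measurability
  of \<open>a\<close> means measurability with respect to \<open>dF\<close>, which includes every Borel function.\<close>

definition stieltjes_on :: "real set \<Rightarrow> (real \<Rightarrow> real) \<Rightarrow> real measure" where
  "stieltjes_on I F = restrict_space (completion (interval_measure F)) I"

text \<open>\<open>F\<close> is a distribution function on the whole line that gives \<open>I\<close> full mass, and only
  the values of \<open>a\<close> on \<open>I\<close> matter.\<close>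

definition game :: "real set \<Rightarrow> (real \<Rightarrow> real) \<Rightarrow> (real \<Rightarrow> real) \<Rightarrow> bool" where
  "game I F a \<longleftrightarrow>
     is_interval I \<and> distribution_function F \<and> emeasure (interval_measure F) I = 1 \<and>
     a \<in> borel_measurable (stieltjes_on I F) \<and>
     \<not> (\<exists>k. AE x in stieltjes_on I F. a x = k)"

text \<open>In what follows \<open>M\<close> is the measure \<open>dF\<close> on \<open>I\<close>. The mean is the integral of the positive
  part minus the integral of the negative part, so it can be \<open>\<infinity>\<close>; the negative part has a
  finite integral whenever \<open>a\<close> is essentially bounded below.\<close>

definition game_mean :: "real measure \<Rightarrow> (real \<Rightarrow> real) \<Rightarrow> ereal" where
  "game_mean M a =
     enn2ereal (\<integral>\<^sup>+ x. ennreal (a x) \<partial>M) - enn2ereal (\<integral>\<^sup>+ x. ennreal (- a x) \<partial>M)"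

definition essinf :: "'a measure \<Rightarrow> ('a \<Rightarrow> ereal) \<Rightarrow> ereal" where
  "essinf M f = - esssup M (\<lambda>x. - f x)"

definition game_xi :: "real measure \<Rightarrow> (real \<Rightarrow> real) \<Rightarrow> real" where
  "game_xi M a = real_of_ereal (essinf M (\<lambda>x. ereal (a x)))"

text \<open>Since \<open>inverse 0 = \<infinity>\<close> in \<^typ>\<open>ennreal\<close>, the integral is \<open>\<infinity>\<close> as soon as \<open>a\<close> takes the value
  \<open>\<xi>\<close> with positive probability; since \<open>inverse \<infinity> = 0\<close>, the reciprocal of an infinite \<open>H\<^sub>\<xi>\<close> is 0.\<close>

definition game_H :: "real measure \<Rightarrow> (real \<Rightarrow> real) \<Rightarrow> ennreal" where
  "game_H M a = (\<integral>\<^sup>+ x. inverse (ennreal (a x - game_xi M a)) \<partial>M)"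

definition game_Psi :: "real measure \<Rightarrow> (real \<Rightarrow> real) \<Rightarrow> real \<Rightarrow> real" where
  "game_Psi M a c = 1 / (LINT x|M. 1 / (a x + c)) - c"

definition opt_prop :: "real measure \<Rightarrow> (real \<Rightarrow> real) \<Rightarrow> real \<Rightarrow> real \<Rightarrow> real" where
  "opt_prop M a m u =
     (THE t. 0 < t \<and> t < u / (u + m - game_xi M a) \<and>
        (LINT x|M. (a x - m - u) / ((a x - m) * t - t * u + u)) = 0)"

definition u_max :: "real measure \<Rightarrow> (real \<Rightarrow> real) \<Rightarrow> real \<Rightarrow> real" where
  "u_max M a m =
     (THE v. 0 < v \<and> ereal v < game_mean M a - ereal m \<and>
        strict_mono_on {0<..<v} (opt_prop M a m) \<and>
        strict_antimono_on {u. v < u \<and> ereal u < game_mean M a - ereal m} (opt_prop M a m))"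

definition associated_measure ::
    "real measure \<Rightarrow> (real \<Rightarrow> real) \<Rightarrow> real measure \<Rightarrow> bool" where
  "associated_measure M a \<rho> \<longleftrightarrow>
     sets \<rho> = sets (restrict_space borel {0<..}) \<and>
     (\<integral>\<^sup>+ t. ennreal (1 / (t * (t + 1))) \<partial>\<rho>) < \<infinity> \<and>
     (\<forall>c > - game_xi M a.
        game_Psi M a c =
          game_xi M a + enn2real (inverse (game_H M a)) +
          (LINT t|\<rho>. (c + game_xi M a) / (t * (t + c + game_xi M a))))"

end

theory Submission
  imports Defs "HOL-Real_Asymp.Real_Asymp"
begin

text \<open>
  Put \<open>s = c + \<xi>\<close>. If \<open>\<rho>\<close> is finite then \<open>\<Psi>(c) = E - g(s)\<close>, where \<open>E\<close> is finite and
  \<open>g(s) = \<integral> \<rho>(dt) / (t + s)\<close> is the Stieltjes transform of \<open>\<rho>\<close>. With \<open>n = m - \<xi>\<close> and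
  \<open>D = E - m\<close>, the optimal proportion is \<open>u / (u + n + s)\<close> for the \<open>s\<close> with \<open>g(s) = D - u\<close>. Between
  \<open>s < s'\<close> this proportion increases or decreases according to the sign of \<open>k(s, s') - D\<close>, where the
  symmetric kernel \<open>k(s, s') = \<integral> (t + s + s' + n) / ((t + s) (t + s')) \<rho>(dt)\<close> is strictly
  decreasing in both arguments. So the maximum is at the \<open>s\<close> with
  \<open>D = k(s, s) = g(s) + (s + n) q(s)\<close>, \<open>q(s) = \<integral> \<rho>(dt) / (t + s)\<^sup>2\<close>, and there \<open>u = (s + n) q(s)\<close>.
  As \<open>D\<close> tends to 0, \<open>s\<close> tends to infinity, and both \<open>s g(s)\<close> and \<open>s (s + n) q(s)\<close> tend to the total
  mass of \<open>\<rho>\<close>, which gives the limit 1/2.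
\<close>

section \<open>The Stieltjes transform of a finite measure on the positive half-line\<close>

locale positive_line_measure = finite_measure \<rho> for \<rho> :: "real measure" +
  assumes sets_\<rho>: "sets \<rho> = sets (restrict_space borel {0<..})"
begin

definition stieltjes :: "real \<Rightarrow> real" where
  "stieltjes s = (LINT t|\<rho>. 1 / (t + s))"

definition stieltjes_sq :: "real \<Rightarrow> real" where
  "stieltjes_sq s = (LINT t|\<rho>. 1 / (t + s)\<^sup>2)"

definition kernel :: "real \<Rightarrow> real \<Rightarrow> real \<Rightarrow> real" where
  "kernel n s s' = (LINT t|\<rho>. (t + s + s' + n) / ((t + s) * (t + s')))"

section \<open>Integrability and algebraic identities\<close>

lemma space_\<rho>: "space \<rho> = {0<..}"
  using sets_eq_imp_space_eq[OF sets_\<rho>] by (simp add: space_restrict_space)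

lemma borel_measurable_\<rho>: "f \<in> borel_measurable borel \<Longrightarrow> f \<in> borel_measurable \<rho>"
  using measurable_restrict_space1[of f borel borel "{0<..}"]
    measurable_cong_sets[OF sets_\<rho> refl] by blast

lemma integrable_bounded:
  fixes f :: "real \<Rightarrow> real"
  assumes "f \<in> borel_measurable borel" "\<And>t. 0 < t \<Longrightarrow> \<bar>f t\<bar> \<le> B"
  shows "integrable \<rho> f"
  using assms borel_measurable_\<rho>
  by (intro integrable_const_bound[of _ B]) (auto intro!: AE_I2 simp: space_\<rho>)

lemma integrable_stieltjes: "0 < s \<Longrightarrow> integrable \<rho> (\<lambda>t. 1 / (t + s))"
  by (rule integrable_bounded[of _ "1 / s"]) (auto simp: field_simps)

lemma integrable_stieltjes_prod:
  assumes "0 < s" "0 < s'"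
  shows "integrable \<rho> (\<lambda>t. 1 / ((t + s) * (t + s')))"
proof (rule integrable_bounded[of _ "1 / (s * s')"])
  fix t :: real assume "0 < t"
  with assms have "s * s' \<le> (t + s) * (t + s')"
    by (intro mult_mono) auto
  with assms \<open>0 < t\<close> show "\<bar>1 / ((t + s) * (t + s'))\<bar> \<le> 1 / (s * s')"
    by (auto intro!: divide_left_mono)
qed simp

lemma kernel_integrand:
  fixes t s s' n :: real
  assumes "0 < t" "0 < s" "0 < s'"
  shows "(t + s + s' + n) / ((t + s) * (t + s')) =
    1 / (t + s) + (s + n) * (1 / ((t + s) * (t + s')))"
  using assms by (simp add: divide_simps)

lemma integrable_kernel:
  assumes "0 < s" "0 < s'"
  shows "integrable \<rho> (\<lambda>t. (t + s + s' + n) / ((t + s) * (t + s')))"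
proof -
  have "integrable \<rho> (\<lambda>t. 1 / (t + s) + (s + n) * (1 / ((t + s) * (t + s'))))"
    using assms
    by (intro Bochner_Integration.integrable_add integrable_mult_right integrable_stieltjes
        integrable_stieltjes_prod)
  then show ?thesis
    using assms by (subst Bochner_Integration.integrable_cong[OF refl kernel_integrand])
      (auto simp: space_\<rho>)
qed

text \<open>This asymmetric form is the one that arises when two proportions are compared; the
  symmetric integrand in the definition is what lets monotonicity in one argument carry over to the
  other.\<close>

lemma kernel_eq:
  assumes "0 < s" "0 < s'"
  shows "kernel n s s' = stieltjes s + (s + n) * (LINT t|\<rho>. 1 / ((t + s) * (t + s')))"
proof -
  have "kernel n s s' = (LINT t|\<rho>. 1 / (t + s) + (s + n) * (1 / ((t + s) * (t + s'))))"
    unfolding kernel_def using assms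
    by (intro Bochner_Integration.integral_cong[OF refl] kernel_integrand) (auto simp: space_\<rho>)
  also have "\<dots> = stieltjes s + (s + n) * (LINT t|\<rho>. 1 / ((t + s) * (t + s')))"
    unfolding stieltjes_def using assms
    by (simp only: Bochner_Integration.integral_add integrable_mult_right integrable_stieltjes
        integrable_stieltjes_prod integral_mult_right_zero)
  finally show ?thesis .
qed

lemma kernel_diag: "0 < s \<Longrightarrow> kernel n s s = stieltjes s + (s + n) * stieltjes_sq s"
  by (simp add: kernel_eq stieltjes_sq_def power2_eq_square)

text \<open>Partial fractions under the integral. The identity yields strict monotonicity of the
  transform and also the increment of the price in \<open>proportion_diff\<close>.\<close>

lemma stieltjes_diff:
  assumes "0 < s" "0 < s'"
  shows "stieltjes s - stieltjes s' = (s' - s) * (LINT t|\<rho>. 1 / ((t + s) * (t + s')))"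
proof -
  have "stieltjes s - stieltjes s' = (LINT t|\<rho>. 1 / (t + s) - 1 / (t + s'))"
    unfolding stieltjes_def using assms integrable_stieltjes by simp
  also have "\<dots> = (LINT t|\<rho>. (s' - s) * (1 / ((t + s) * (t + s'))))"
    using assms by (intro Bochner_Integration.integral_cong[OF refl])
      (auto simp: space_\<rho> divide_simps)
  also have "\<dots> = (s' - s) * (LINT t|\<rho>. 1 / ((t + s) * (t + s')))"
    by (rule integral_mult_right_zero)
  finally show ?thesis .
qed

section \<open>Continuity and asymptotics at infinity\<close>

lemma continuous_on_integral_bounded:
  fixes f :: "real \<Rightarrow> real \<Rightarrow> real"
  assumes "\<And>s. f s \<in> borel_measurable borel"
    and "\<And>s t. 1 \<le> s \<Longrightarrow> 0 < t \<Longrightarrow> \<bar>f s t\<bar> \<le> 1"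
    and "\<And>t. 0 < t \<Longrightarrow> continuous_on {1..} (\<lambda>s. f s t)"
  shows "continuous_on {1..} (\<lambda>s. LINT t|\<rho>. f s t)"
  unfolding continuous_on_sequentially
proof (safe, unfold o_def)
  fix X :: "nat \<Rightarrow> real" and s
  assume s: "1 \<le> s" "\<forall>n. X n \<in> {1..}" "X \<longlonglongrightarrow> s"
  show "(\<lambda>i. LINT t|\<rho>. f (X i) t) \<longlonglongrightarrow> (LINT t|\<rho>. f s t)"
  \<comment> \<open>The measure is finite, so the constant 1 is an integrable bound; it dominates
    the intended integrands \<open>1 / (t + s)\<close> and \<open>1 / (t + s)\<^sup>2\<close> as
    long as \<open>s\<close> is at least 1.\<close>
  proof (rule integral_dominated_convergence[where w="\<lambda>_. 1"])
    show "AE t in \<rho>. (\<lambda>i. f (X i) t) \<longlonglongrightarrow> f s t"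
    proof (rule AE_I2)
      fix t assume "t \<in> space \<rho>"
      then have "continuous_on {1..} (\<lambda>s. f s t)"
        using assms(3) by (simp add: space_\<rho>)
      then show "(\<lambda>i. f (X i) t) \<longlonglongrightarrow> f s t"
        using s by (auto simp: continuous_on_sequentially o_def)
    qed
    show "AE t in \<rho>. norm (f (X i) t) \<le> 1" for i
      using assms(2) s(2) by (auto intro!: AE_I2 simp: space_\<rho>)
  qed (use assms(1) borel_measurable_\<rho> in auto)
qed

lemma continuous_on_stieltjes: "continuous_on {1..} stieltjes"
proof -
  have "continuous_on {1..} (\<lambda>s. LINT t|\<rho>. 1 / (t + s))"
    by (rule continuous_on_integral_bounded) (auto intro!: continuous_intros)
  then show ?thesis
    by (simp add: stieltjes_def[abs_def])
qed

lemma continuous_on_stieltjes_sq: "continuous_on {1..} stieltjes_sq"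
proof -
  have "continuous_on {1..} (\<lambda>s. LINT t|\<rho>. 1 / (t + s)\<^sup>2)"
    by (rule continuous_on_integral_bounded) (auto intro!: continuous_intros)
  then show ?thesis
    by (simp add: stieltjes_sq_def[abs_def])
qed

lemma tendsto_times_stieltjes: "((\<lambda>s. s * stieltjes s) \<longlongrightarrow> measure \<rho> (space \<rho>)) at_top"
proof -
  have "((\<lambda>s. LINT t|\<rho>. s / (t + s)) \<longlongrightarrow> (LINT t|\<rho>. 1)) at_top"
  proof (rule integral_dominated_convergence_at_top[where w="\<lambda>_. 1"])
    show "AE t in \<rho>. ((\<lambda>s. s / (t + s)) \<longlongrightarrow> 1) at_top"
      by (rule AE_I2) real_asymp
    show "\<forall>\<^sub>F s in at_top. AE t in \<rho>. norm (s / (t + s)) \<le> 1"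
      by (rule eventually_mono[OF eventually_gt_at_top[of 0]])
        (auto intro!: AE_I2 simp: space_\<rho>)
  qed (auto intro: borel_measurable_\<rho>)
  then show ?thesis
    by (simp add: stieltjes_def flip: Bochner_Integration.integral_mult_right_zero)
qed

lemma tendsto_power2_stieltjes_sq:
  "((\<lambda>s. s\<^sup>2 * stieltjes_sq s) \<longlongrightarrow> measure \<rho> (space \<rho>)) at_top"
proof -
  have "((\<lambda>s. LINT t|\<rho>. s\<^sup>2 / (t + s)\<^sup>2) \<longlongrightarrow> (LINT t|\<rho>. 1)) at_top"
  proof (rule integral_dominated_convergence_at_top[where w="\<lambda>_. 1"])
    show "AE t in \<rho>. ((\<lambda>s. s\<^sup>2 / (t + s)\<^sup>2) \<longlongrightarrow> 1) at_top"
      by (rule AE_I2) real_asymp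
    show "\<forall>\<^sub>F s in at_top. AE t in \<rho>. norm (s\<^sup>2 / (t + s)\<^sup>2) \<le> 1"
      by (rule eventually_mono[OF eventually_gt_at_top[of 0]])
        (auto intro!: AE_I2 power_mono simp: space_\<rho>)
  qed (auto intro: borel_measurable_\<rho>)
  then show ?thesis
    by (simp add: stieltjes_sq_def flip: Bochner_Integration.integral_mult_right_zero)
qed

lemma tendsto_stieltjes: "(stieltjes \<longlongrightarrow> 0) at_top"
proof -
  have "((\<lambda>s. (s * stieltjes s) * inverse s) \<longlongrightarrow> measure \<rho> (space \<rho>) * 0) at_top"
    by (intro tendsto_mult tendsto_times_stieltjes tendsto_inverse_0_at_top filterlim_ident)
  then show ?thesis
    by (rule Lim_transform_eventually[OF tendsto_eq_rhs])
      (auto intro: eventually_mono[OF eventually_gt_at_top[of 0]])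
qed

lemma tendsto_kernel_diag: "((\<lambda>s. kernel n s s) \<longlongrightarrow> 0) at_top"
proof -
  have "((\<lambda>s. stieltjes s + ((s + n) / s\<^sup>2) * (s\<^sup>2 * stieltjes_sq s)) \<longlongrightarrow>
      0 + 0 * measure \<rho> (space \<rho>)) at_top"
    by (intro tendsto_add tendsto_mult tendsto_stieltjes tendsto_power2_stieltjes_sq) real_asymp
  then show ?thesis
    by (rule Lim_transform_eventually[OF tendsto_eq_rhs])
      (auto intro: eventually_mono[OF eventually_gt_at_top[of 0]] simp: kernel_diag)
qed

end

section \<open>Strict monotonicity and inversion for a nonzero measure\<close>

locale nonzero_line_measure = positive_line_measure +
  assumes mass_pos: "emeasure \<rho> (space \<rho>) \<noteq> 0"
begin

lemma measure_pos: "0 < measure \<rho> (space \<rho>)"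
  using mass_pos by (simp add: emeasure_eq_measure zero_less_measure_iff)

lemma integral_strict_mono:
  fixes f h :: "real \<Rightarrow> real"
  assumes "integrable \<rho> f" "integrable \<rho> h" "\<And>t. 0 < t \<Longrightarrow> f t < h t"
  shows "(LINT t|\<rho>. f t) < (LINT t|\<rho>. h t)"
  using assms mass_pos
  by (intro integral_less_AE_space) (auto intro!: AE_I2 simp: space_\<rho>)

lemma stieltjes_prod_pos: "0 < s \<Longrightarrow> 0 < s' \<Longrightarrow> 0 < (LINT t|\<rho>. 1 / ((t + s) * (t + s')))"
  using integral_strict_mono[of "\<lambda>_. 0" "\<lambda>t. 1 / ((t + s) * (t + s'))"]
    integrable_stieltjes_prod[of s s'] by auto

lemma stieltjes_sq_pos: "0 < s \<Longrightarrow> 0 < stieltjes_sq s"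
  using stieltjes_prod_pos[of s s] by (simp add: stieltjes_sq_def power2_eq_square)

lemma stieltjes_pos: "0 < s \<Longrightarrow> 0 < stieltjes s"
  unfolding stieltjes_def
  using integral_strict_mono[of "\<lambda>_. 0" "\<lambda>t. 1 / (t + s)"] integrable_stieltjes[of s] by auto

lemma stieltjes_strict_antimono: "0 < s \<Longrightarrow> s < s' \<Longrightarrow> stieltjes s' < stieltjes s"
  using stieltjes_diff[of s s'] stieltjes_prod_pos[of s s']
  by (smt (verit) mult_pos_pos)

lemma stieltjes_less_iff: "0 < s \<Longrightarrow> 0 < s' \<Longrightarrow> stieltjes s < stieltjes s' \<longleftrightarrow> s' < s"
  by (metis linorder_neqE_linordered_idom order_less_asym stieltjes_strict_antimono)

lemma stieltjes_eq_iff: "0 < s \<Longrightarrow> 0 < s' \<Longrightarrow> stieltjes s = stieltjes s' \<longleftrightarrow> s = s'"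
  by (metis linorder_neqE_linordered_idom order_less_irrefl stieltjes_strict_antimono)

lemma kernel_commute: "kernel n s s' = kernel n s' s"
  by (simp add: kernel_def algebra_simps)

text \<open>With \<open>s\<close> fixed, the integrand is
  \<open>(1 + (s + n) / (t + r)) / (t + s)\<close>, so \<open>r\<close> enters only through one
  fraction with positive numerator.\<close>

lemma kernel_strict_antimono:
  assumes "0 < s" "0 < r" "r < r'" "0 < n"
  shows "kernel n s r' < kernel n s r"
proof -
  have "(t + s + r' + n) / ((t + s) * (t + r')) < (t + s + r + n) / ((t + s) * (t + r))"
    if "0 < t" for t
  proof -
    have *: "(t + s + q + n) / ((t + s) * (t + q)) = (1 + (s + n) / (t + q)) / (t + s)"
      if "0 < q" for q
      using that \<open>0 < t\<close> assms by (simp add: divide_simps)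
    have "(s + n) / (t + r') < (s + n) / (t + r)"
      using assms that by (intro divide_strict_left_mono) auto
    then show ?thesis
      using assms that by (simp add: * divide_strict_right_mono)
  qed
  then show ?thesis
    unfolding kernel_def using assms by (intro integral_strict_mono integrable_kernel) auto
qed

text \<open>Intermediate values between 1, where the continuity result starts, and a point far out.
  Prices correspond to small \<open>y\<close>, so the threshold \<open>stieltjes 1\<close> does no
  harm near the limit.\<close>

lemma stieltjes_surj:
  assumes "0 < y" "y < stieltjes 1"
  shows "\<exists>s>1. stieltjes s = y"
proof -
  have "\<forall>\<^sub>F s in at_top. stieltjes s < y \<and> 1 < s"
    using order_tendstoD(2)[OF tendsto_stieltjes \<open>0 < y\<close>] eventually_gt_at_top[of 1]
    by eventually_elim simp
  then obtain S where S: "stieltjes S < y" "1 < S"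
    by (metis (lifting) eventually_happens' trivial_limit_at_top_linorder)
  have "continuous_on {1..S} stieltjes"
    by (rule continuous_on_subset[OF continuous_on_stieltjes]) auto
  then obtain s where "1 \<le> s" "stieltjes s = y"
    using IVT2'[of stieltjes S y 1] S assms by auto
  with assms show ?thesis
    by (metis order_le_less order_less_irrefl)
qed

text \<open>At 1 the diagonal exceeds the transform, so the threshold of
  \<open>stieltjes_surj\<close> serves here too and one smallness condition covers both
  inversions.\<close>

lemma kernel_diag_surj:
  assumes "0 < y" "y < stieltjes 1" "0 < n"
  shows "\<exists>s>1. kernel n s s = y"
proof -
  have 1: "y < kernel n 1 1"
    unfolding kernel_diag[OF zero_less_one]
    using assms mult_pos_pos[of "1 + n" "stieltjes_sq 1"] stieltjes_sq_pos[of 1] by linarith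
  have "\<forall>\<^sub>F s in at_top. kernel n s s < y \<and> 1 < s"
    using order_tendstoD(2)[OF tendsto_kernel_diag \<open>0 < y\<close>] eventually_gt_at_top[of 1]
    by eventually_elim simp
  then obtain S where S: "kernel n S S < y" "1 < S"
    by (metis (lifting) eventually_happens' trivial_limit_at_top_linorder)
  have "continuous_on {1..S} (\<lambda>s. stieltjes s + (s + n) * stieltjes_sq s)"
    by (intro continuous_intros continuous_on_subset[OF continuous_on_stieltjes]
        continuous_on_subset[OF continuous_on_stieltjes_sq]) auto
  then have "continuous_on {1..S} (\<lambda>s. kernel n s s)"
    by (subst continuous_on_cong[OF refl kernel_diag]) auto
  then obtain s where "1 \<le> s" "kernel n s s = y"
    using IVT2'[of "\<lambda>s. kernel n s s" S y 1] S 1 by auto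
  with 1 show ?thesis
    by (metis order_le_less order_less_irrefl)
qed

text \<open>After multiplying numerator and denominator by \<open>s m\<close>, both summands of the
  diagonal kernel tend to the total mass \<open>?R\<close>, so the ratio tends to
  \<open>?R / (?R + ?R)\<close>. The shift \<open>n\<close> may vary with \<open>m\<close>, as its
  contribution is damped by \<open>inverse (s m)\<close>.\<close>

lemma tendsto_increment_ratio:
  assumes "filterlim s at_top G" "(n \<longlongrightarrow> L) G"
  shows "((\<lambda>m. (s m + n m) * stieltjes_sq (s m) / kernel (n m) (s m) (s m)) \<longlongrightarrow> 1 / 2) G"
proof -
  let ?R = "measure \<rho> (space \<rho>)"
  have inv: "((\<lambda>m. inverse (s m)) \<longlongrightarrow> 0) G"
    by (rule tendsto_inverse_0_at_top[OF assms(1)])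
  have g: "((\<lambda>m. s m * stieltjes (s m)) \<longlongrightarrow> ?R) G"
    by (rule filterlim_compose[OF tendsto_times_stieltjes assms(1)])
  have "((\<lambda>m. (1 + n m * inverse (s m)) * ((s m)\<^sup>2 * stieltjes_sq (s m))) \<longlongrightarrow> (1 + L * 0) * ?R) G"
    by (intro tendsto_intros assms inv filterlim_compose[OF tendsto_power2_stieltjes_sq assms(1)])
  then have q: "((\<lambda>m. (1 + n m * inverse (s m)) * ((s m)\<^sup>2 * stieltjes_sq (s m))) \<longlongrightarrow> ?R) G"
    by simp
  have "((\<lambda>m. (1 + n m * inverse (s m)) * ((s m)\<^sup>2 * stieltjes_sq (s m)) /
      (s m * stieltjes (s m) + (1 + n m * inverse (s m)) * ((s m)\<^sup>2 * stieltjes_sq (s m))))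
      \<longlongrightarrow> ?R / (?R + ?R)) G"
    using measure_pos by (intro tendsto_divide tendsto_add g q) auto
  then have "((\<lambda>m. (1 + n m * inverse (s m)) * ((s m)\<^sup>2 * stieltjes_sq (s m)) /
      (s m * stieltjes (s m) + (1 + n m * inverse (s m)) * ((s m)\<^sup>2 * stieltjes_sq (s m))))
      \<longlongrightarrow> 1 / 2) G"
    using measure_pos by (simp split: if_splits)
  moreover have "\<forall>\<^sub>F m in G. (1 + n m * inverse (s m)) * ((s m)\<^sup>2 * stieltjes_sq (s m)) /
      (s m * stieltjes (s m) + (1 + n m * inverse (s m)) * ((s m)\<^sup>2 * stieltjes_sq (s m)))
      = (s m + n m) * stieltjes_sq (s m) / kernel (n m) (s m) (s m)"
    using filterlim_at_top_dense[THEN iffD1, OF assms(1), rule_format, of 0]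
  proof eventually_elim
    case (elim m)
    then have *: "(1 + n m * inverse (s m)) * ((s m)\<^sup>2 * stieltjes_sq (s m))
        = s m * ((s m + n m) * stieltjes_sq (s m))"
      by (simp add: field_simps power2_eq_square)
    with elim show ?case
      by (simp add: * kernel_diag flip: distrib_left)
  qed
  ultimately show ?thesis
    by (rule Lim_transform_eventually)
qed

end

section \<open>Games and their optimal proportions\<close>

text \<open>\<open>L\<close> stands for the mean minus \<open>\<xi>\<close>, which
  \<open>mean_shift\<close> establishes. Here \<open>\<xi>\<close> is an almost sure lower bound;
  its identification with \<open>game_xi M a\<close> is a separate hypothesis where
  \<open>opt_prop\<close> is unfolded.\<close>

locale stieltjes_game = prob_space M + rho: positive_line_measure \<rho>
  for M \<rho> :: "real measure" +
  fixes a :: "real \<Rightarrow> real" and \<xi> L :: real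
  assumes a_measurable [measurable]: "a \<in> borel_measurable M"
    and a_lower: "AE x in M. \<xi> \<le> a x"
    and Psi_eq: "\<And>s. 0 < s \<Longrightarrow> game_Psi M a (s - \<xi>) = \<xi> + L - rho.stieltjes s"
    and nonconst: "\<And>k. \<not> (AE x in M. a x = k)"
begin

section \<open>Reciprocal moments and finiteness of the mean\<close>

definition recip :: "real \<Rightarrow> real" where
  "recip s = (LINT x|M. 1 / (a x + (s - \<xi>)))"

lemma integrable_recip:
  assumes "0 < s"
  shows "integrable M (\<lambda>x. 1 / (a x + (s - \<xi>)))"
proof (rule integrable_const_bound[of _ "1 / s"])
  show "AE x in M. norm (1 / (a x + (s - \<xi>))) \<le> 1 / s"
    using a_lower by eventually_elim (use assms in \<open>auto simp: field_simps\<close>)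
qed simp

lemma recip_pos:
  assumes "0 < s"
  shows "0 < recip s"
proof -
  have "(LINT x|M. 0) < (LINT x|M. 1 / (a x + (s - \<xi>)))"
  proof (rule integral_less_AE_space)
    show "AE x in M. 0 < 1 / (a x + (s - \<xi>))"
      using a_lower by eventually_elim (use assms in auto)
  qed (use assms integrable_recip emeasure_space_1 in auto)
  then show ?thesis
    by (simp add: recip_def)
qed

lemma recip_le:
  assumes "0 < s"
  shows "recip s \<le> 1 / s"
proof -
  have "(LINT x|M. 1 / (a x + (s - \<xi>))) \<le> (LINT x|M. 1 / s)"
  proof (rule integral_mono_AE)
    show "AE x in M. 1 / (a x + (s - \<xi>)) \<le> 1 / s"
      using a_lower by eventually_elim (use assms in \<open>auto simp: field_simps\<close>)
  qed (use assms integrable_recip in auto)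
  then show ?thesis
    by (simp add: recip_def prob_space)
qed

lemma inverse_recip: "0 < s \<Longrightarrow> 1 / recip s = s + L - rho.stieltjes s"
  using Psi_eq[of s] by (simp add: game_Psi_def recip_def)

lemma recip_eq: "0 < s \<Longrightarrow> recip s = 1 / (s + L - rho.stieltjes s)"
  by (simp flip: inverse_recip)

text \<open>With \<open>b = a - \<xi>\<close>, the functions
  \<open>s - s\<^sup>2 / (b + s) = s b / (b + s)\<close> increase to \<open>b\<close> as
  \<open>s\<close> grows. Their expectations are known from \<open>recip s\<close> and tend to
  \<open>L\<close>, so monotone convergence gives integrability and the mean at once.\<close>

lemma mean_shift: "has_bochner_integral M (\<lambda>x. a x - \<xi>) L"
proof (rule has_bochner_integral_monotone_convergence)
  \<comment> \<open>The shift by 1 keeps the parameter positive at index 0.\<close>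
  let ?s = "\<lambda>i. real i + 1"
  let ?f = "\<lambda>i x. ?s i - (?s i)\<^sup>2 * (1 / (a x + (?s i - \<xi>)))"
  have f_eq: "?f i x = ?s i * (a x - \<xi>) / (a x - \<xi> + ?s i)" if "\<xi> \<le> a x" for i x
  proof -
    have "a x - \<xi> + ?s i > 0"
      using that by simp
    then show ?thesis
      by (simp add: divide_simps) (simp add: power2_eq_square algebra_simps)
  qed
  show "integrable M (?f i)" for i
    by (intro Bochner_Integration.integrable_diff integrable_const integrable_mult_right
        integrable_recip) simp
  show "AE x in M. mono (\<lambda>i. ?f i x)"
    using a_lower
  proof eventually_elim
    case (elim x)
    show ?case
    proof (rule monoI)
      fix i j :: nat assume "i \<le> j"
      then have s: "?s i \<le> ?s j" "0 < ?s i"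
        by auto
      define b where "b = a x - \<xi>"
      \<comment> \<open>After cross-multiplication the mixed terms cancel and only this comparison
        remains.\<close>
      have "?s i * (b * b) \<le> ?s j * (b * b)"
        using s(1) by (rule mult_right_mono) simp
      then have "?s i * (a x - \<xi>) * (a x - \<xi> + ?s j) \<le> ?s j * (a x - \<xi>) * (a x - \<xi> + ?s i)"
        unfolding b_def[symmetric] by argo
      then have "?s i * (a x - \<xi>) / (a x - \<xi> + ?s i) \<le> ?s j * (a x - \<xi>) / (a x - \<xi> + ?s j)"
        using elim by (subst frac_le_eq) (auto intro!: divide_nonpos_pos mult_pos_pos)
      then show "?f i x \<le> ?f j x"
        by (simp only: f_eq[OF elim])
    qed
  qed
  show "AE x in M. (\<lambda>i. ?f i x) \<longlonglongrightarrow> a x - \<xi>"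
    using a_lower
  proof eventually_elim
    case (elim x)
    have "(\<lambda>i. ?s i * (a x - \<xi>) / (a x - \<xi> + ?s i)) \<longlonglongrightarrow> a x - \<xi>"
      by real_asymp
    then show ?case
      by (simp only: f_eq[OF elim])
  qed
  have s_top: "filterlim ?s at_top sequentially"
    by real_asymp
  have g: "(\<lambda>i. L - rho.stieltjes (?s i)) \<longlonglongrightarrow> L - 0"
    by (intro tendsto_intros filterlim_compose[OF rho.tendsto_stieltjes s_top])
  have "(\<lambda>i. (L - rho.stieltjes (?s i)) / (1 + (L - rho.stieltjes (?s i)) * inverse (?s i)))
      \<longlonglongrightarrow> (L - 0) / (1 + (L - 0) * 0)"
    by (intro tendsto_divide tendsto_add tendsto_mult tendsto_const g
        tendsto_inverse_0_at_top s_top) auto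
  moreover have "(LINT x|M. ?f i x) =
      (L - rho.stieltjes (?s i)) / (1 + (L - rho.stieltjes (?s i)) * inverse (?s i))" for i
  proof -
    define s g where "s = ?s i" and "g = rho.stieltjes s"
    have s: "0 < s"
      by (simp add: s_def)
    have "(LINT x|M. ?f i x) = s - s\<^sup>2 * recip s"
      unfolding recip_def s_def[symmetric] using integrable_recip[OF s]
      by (simp add: prob_space del: times_divide_eq_right mult_1_right)
    moreover have "0 < s + L - g"
      using recip_pos[OF s] inverse_recip[OF s] unfolding g_def by (metis zero_less_divide_1_iff)
    then have "s - s\<^sup>2 * (1 / (s + L - g)) = (L - g) / (1 + (L - g) * inverse s)"
      using s by (simp add: divide_simps) (simp add: power2_eq_square algebra_simps)
    ultimately show ?thesis
      using recip_eq[OF s] by (simp add: s_def g_def)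
  qed
  ultimately show "(\<lambda>i. LINT x|M. ?f i x) \<longlonglongrightarrow> L"
    by simp
qed simp

lemma integrable_a: "integrable M a"
  using Bochner_Integration.integrable_add[of M "\<lambda>x. a x - \<xi>" "\<lambda>_. \<xi>"] mean_shift
  by (simp add: has_bochner_integral_iff)

lemma expectation_a: "expectation a = \<xi> + L"
  using mean_shift integrable_a
  by (simp add: has_bochner_integral_iff prob_space)

lemma game_mean_eq: "game_mean M a = ereal (\<xi> + L)"
proof -
  have "(\<integral>\<^sup>+ x. ennreal (a x) \<partial>M) \<noteq> \<infinity>" "(\<integral>\<^sup>+ x. ennreal (- a x) \<partial>M) \<noteq> \<infinity>"
    using integrable_a by (auto simp: real_integrable_def)
  then show ?thesis
    unfolding game_mean_def expectation_a[symmetric] real_lebesgue_integral_def[OF integrable_a]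
    by (cases "\<integral>\<^sup>+ x. ennreal (a x) \<partial>M"; cases "\<integral>\<^sup>+ x. ennreal (- a x) \<partial>M")
      (auto simp: enn2ereal_ennreal)
qed

text \<open>If \<open>\<rho>\<close> vanished, then \<open>1 / E[1 / (b + 1)] = 1 + E[b]\<close> for \<open>b = a - \<xi>\<close>, which is the
  equality case of Jensen's inequality.\<close>

lemma mass_nonzero: "emeasure \<rho> (space \<rho>) \<noteq> 0"
proof
  assume "emeasure \<rho> (space \<rho>) = 0"
  then have "AE t in \<rho>. False"
    by (intro AE_I[of _ _ "space \<rho>"]) auto
  then have "rho.stieltjes 1 = 0"
    unfolding rho.stieltjes_def by (intro integral_eq_zero_AE) auto
  then have K: "recip 1 = 1 / (1 + L)"
    using recip_eq[of 1] by simp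
  have L: "1 + L \<noteq> 0"
    using recip_pos[of 1] K by auto
  \<comment> \<open>With \<open>b = a - \<xi>\<close> and \<open>y = b + 1\<close>, this is
    \<open>(b - L)\<^sup>2 / y\<close> expanded as
    \<open>y - 2 (1 + L) + (1 + L)\<^sup>2 / y\<close>. It is nonnegative, and its expectation,
    computed from the mean and \<open>recip 1\<close>, is 0; hence \<open>b = L\<close> almost
    surely.\<close>
  let ?h = "\<lambda>x. (a x - \<xi>) + (1 - 2 * (1 + L)) + (1 + L)\<^sup>2 * (1 / (a x + (1 - \<xi>)))"
  have h_eq: "?h x = (a x - \<xi> - L)\<^sup>2 / (a x - \<xi> + 1)" if "\<xi> \<le> a x" for x
  proof -
    have "a x - \<xi> + 1 > 0"
      using that by simp
    then show ?thesis
      by (simp add: divide_simps) (simp add: power2_eq_square algebra_simps)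
  qed
  have int: "integrable M ?h"
    by (intro Bochner_Integration.integrable_add Bochner_Integration.integrable_diff
        integrable_const integrable_mult_right integrable_recip integrable_a) simp
  have "(LINT x|M. ?h x) = L + (1 - 2 * (1 + L)) + (1 + L)\<^sup>2 * recip 1"
    unfolding recip_def using expectation_a
    by (simp add: prob_space integrable_a integrable_recip del: times_divide_eq_right mult_1_right)
  also have "\<dots> = 0"
    using L by (simp add: K power2_eq_square)
  finally have "(LINT x|M. ?h x) = 0" .
  moreover have "AE x in M. 0 \<le> ?h x"
    using a_lower
  proof eventually_elim
    case (elim x)
    then show ?case
      unfolding h_eq[OF elim] by simp
  qed
  ultimately have "AE x in M. ?h x = 0"
    using integral_nonneg_eq_0_iff_AE[OF int] by simp
  with a_lower have "AE x in M. a x = \<xi> + L"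
  proof eventually_elim
    case (elim x)
    have "(a x - \<xi> - L)\<^sup>2 / (a x - \<xi> + 1) = 0"
      using elim(2) unfolding h_eq[OF elim(1)] .
    then show ?case
      using elim(1) by auto
  qed
  with nonconst show False
    by blast
qed

sublocale rho: nonzero_line_measure \<rho>
  by unfold_locales (rule mass_nonzero)

text \<open>Since \<open>a - \<xi>\<close> is nonnegative, \<open>recip 1\<close> is at most 1,
  which forces \<open>L\<close> to be at least \<open>rho.stieltjes 1\<close>. Positivity makes
  \<open>m - \<xi>\<close> positive for \<open>m\<close> near the mean.\<close>

lemma L_pos: "0 < L"
proof -
  have "1 \<le> 1 / recip 1"
    using recip_pos[of 1] recip_le[of 1] by simp
  then show ?thesis
    using inverse_recip[of 1] rho.stieltjes_pos[of 1] by simp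
qed

text \<open>The proportion \<open>t\<close> enters through the substitution \<open>s = u / t - u - n\<close> with \<open>n = m - \<xi>\<close>,
  which turns the denominator into \<open>t (a - \<xi> + s)\<close>.\<close>

lemma optimality_iff:
  assumes "0 < s" "0 < u" "0 < n"
  defines "t \<equiv> u / (u + n + s)"
  shows "(LINT x|M. (a x - (\<xi> + n) - u) / ((a x - (\<xi> + n)) * t - t * u + u)) = 0 \<longleftrightarrow>
    rho.stieltjes s = L - n - u"
proof -
  have t: "0 < t" and ut: "u = t * (u + n + s)"
    using assms by (auto simp: t_def)
  \<comment> \<open>The numerator is \<open>(a - \<xi> + s) - (u + n + s)\<close>, so the quotient
    is affine in the reciprocal and its integral involves only \<open>recip s\<close>.\<close>
  have "(LINT x|M. (a x - (\<xi> + n) - u) / ((a x - (\<xi> + n)) * t - t * u + u)) =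
      (LINT x|M. (1 / t) * (1 - (u + n + s) * (1 / (a x + (s - \<xi>)))))"
  proof (rule integral_cong_AE)
    show "AE x in M. (a x - (\<xi> + n) - u) / ((a x - (\<xi> + n)) * t - t * u + u) =
        (1 / t) * (1 - (u + n + s) * (1 / (a x + (s - \<xi>))))"
      using a_lower
    proof eventually_elim
      case (elim x)
      have "(a x - (\<xi> + n)) * t - t * u + u = t * (a x + (s - \<xi>))"
        using ut by (simp add: algebra_simps)
      moreover have "0 < a x + (s - \<xi>)"
        using elim assms by simp
      ultimately show ?case
        using t by (simp add: divide_simps)
    qed
  qed auto
  also have "\<dots> = (1 / t) * (1 - (u + n + s) * recip s)"
    unfolding recip_def using integrable_recip[OF \<open>0 < s\<close>]
    by (simp add: prob_space del: times_divide_eq_right mult_1_right)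
  also have "\<dots> = 0 \<longleftrightarrow> 1 / recip s = u + n + s"
    using t recip_pos[OF \<open>0 < s\<close>] by (auto simp: field_simps)
  finally show ?thesis
    using inverse_recip[OF \<open>0 < s\<close>] by auto
qed

section \<open>Optimal proportions and their maximum\<close>

lemma opt_prop_eq:
  assumes "game_xi M a = \<xi>" "0 < s" "0 < u" "0 < n" "rho.stieltjes s = L - n - u"
  shows "opt_prop M a (\<xi> + n) u = u / (u + n + s)"
  unfolding opt_prop_def assms(1)
proof (rule the_equality, safe)
  show "0 < u / (u + n + s)" "u / (u + n + s) < u / (u + (\<xi> + n) - \<xi>)"
    using assms by (auto intro!: divide_strict_left_mono)
  show "(LINT x|M. (a x - (\<xi> + n) - u) /
      ((a x - (\<xi> + n)) * (u / (u + n + s)) - u / (u + n + s) * u + u)) = 0"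
    using optimality_iff[of s u n] assms by simp
next
  fix t
  assume t: "0 < t" "t < u / (u + (\<xi> + n) - \<xi>)"
    and 0: "(LINT x|M. (a x - (\<xi> + n) - u) / ((a x - (\<xi> + n)) * t - t * u + u)) = 0"
  \<comment> \<open>The substitution inverted: the upper bound on \<open>t\<close> says exactly that
    \<open>s'\<close> is positive, so uniqueness of \<open>t\<close> reduces to injectivity of the
    transform.\<close>
  define s' where "s' = u / t - u - n"
  have s': "0 < s'"
    using t assms by (simp add: s'_def field_simps)
  have t_eq: "t = u / (u + n + s')"
    using t assms by (simp add: s'_def)
  have "rho.stieltjes s' = rho.stieltjes s"
    using optimality_iff[of s' u n] s' 0 assms by (simp flip: t_eq)
  then show "t = u / (u + n + s)"
    using rho.stieltjes_eq_iff[OF s' \<open>0 < s\<close>] t_eq by simp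
qed

text \<open>Cross-multiplying the two proportions leaves \<open>(s' - s) ((s + n) p - u)\<close>,
  and the last factor equals \<open>rho.kernel n s s' - D\<close>.\<close>

lemma proportion_diff:
  assumes "0 < s" "s < s'" "0 < n" "0 < u" "0 < u'"
    and "rho.stieltjes s = D - u" "rho.stieltjes s' = D - u'"
  shows "u / (u + n + s) < u' / (u' + n + s') \<longleftrightarrow> D < rho.kernel n s s'"
    and "u' / (u' + n + s') < u / (u + n + s) \<longleftrightarrow> rho.kernel n s s' < D"
proof -
  define p where "p = (LINT t|\<rho>. 1 / ((t + s) * (t + s')))"
  have k: "rho.kernel n s s' = D - u + (s + n) * p"
    using rho.kernel_eq[of s s' n] assms by (simp add: p_def)
  have d: "u' = u + (s' - s) * p"
    using rho.stieltjes_diff[of s s'] assms by (simp add: p_def)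
  have *: "u' * (u + n + s) - u * (u' + n + s') = (s' - s) * ((s + n) * p - u)"
    unfolding d by algebra
  have pos: "0 < u + n + s" "0 < u' + n + s'" "0 < s' - s"
    using assms by auto
  have "u / (u + n + s) < u' / (u' + n + s') \<longleftrightarrow> 0 < (s' - s) * ((s + n) * p - u)"
    unfolding *[symmetric] using pos by (simp add: divide_simps mult.commute)
  then show "u / (u + n + s) < u' / (u' + n + s') \<longleftrightarrow> D < rho.kernel n s s'"
    using pos(3) unfolding k by (simp add: zero_less_mult_iff)
  have "u' / (u' + n + s') < u / (u + n + s) \<longleftrightarrow> (s' - s) * ((s + n) * p - u) < 0"
    unfolding *[symmetric] using pos by (simp add: divide_simps mult.commute)
  then show "u' / (u' + n + s') < u / (u + n + s) \<longleftrightarrow> rho.kernel n s s' < D"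
    using pos(3) unfolding k by (simp add: mult_less_0_iff)
qed

text \<open>Larger prices correspond to larger \<open>s\<close>, and the price \<open>v\<close>
  corresponds to \<open>r\<close>. Below \<open>v\<close> the kernel exceeds its value
  \<open>D\<close> at \<open>(r, r)\<close>, above \<open>v\<close> it stays under it, and
  \<open>proportion_diff\<close> turns this into monotonicity.\<close>

lemma u_max_eq:
  assumes xi: "game_xi M a = \<xi>" and n: "0 < n" "n < L" "L - n < rho.stieltjes 1"
    and r: "0 < r" "rho.kernel n r r = L - n"
  shows "u_max M a (\<xi> + n) = (r + n) * rho.stieltjes_sq r"
proof -
  define D where "D = L - n"
  define v where "v = (r + n) * rho.stieltjes_sq r"
  have v: "rho.stieltjes r = D - v"
    using rho.kernel_diag[of r n] r by (simp add: D_def v_def)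
  have v_pos: "0 < v"
    using rho.stieltjes_sq_pos[of r] r n by (simp add: v_def)
  have v_less: "v < D"
    using rho.stieltjes_pos[of r] r v by simp
  have dom: "game_mean M a - ereal (\<xi> + n) = ereal D"
    by (simp add: game_mean_eq D_def)
  have ex: "\<exists>s>1. rho.stieltjes s = D - u" if "0 < u" "u < D" for u
    using rho.stieltjes_surj[of "D - u"] that n by (simp add: D_def)
  have opt: "opt_prop M a (\<xi> + n) u = u / (u + n + s)"
    if "0 < s" "0 < u" "rho.stieltjes s = D - u" for s u
    using opt_prop_eq[of s u n] that xi n by (simp add: D_def)
  have inc: "strict_mono_on {0<..<v} (opt_prop M a (\<xi> + n))"
  proof (rule strict_mono_onI)
    fix u u' assume "u \<in> {0<..<v}" "u' \<in> {0<..<v}" "u < u'"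
    then have u: "0 < u" "u < u'" "u' < v"
      by auto
    obtain s s' where s: "1 < s" "rho.stieltjes s = D - u" "1 < s'" "rho.stieltjes s' = D - u'"
      using ex[of u] ex[of u'] u v_less by auto
    have "s < s'" "s' < r"
      using rho.stieltjes_less_iff[of s' s] rho.stieltjes_less_iff[of r s'] s u v r by auto
    \<comment> \<open>The arguments are lowered one at a time, from \<open>(r, r)\<close> through
      \<open>(s, r)\<close> to \<open>(s, s')\<close>.\<close>
    then have "rho.kernel n r r < rho.kernel n s s'"
      using rho.kernel_strict_antimono[of s s' r n] rho.kernel_strict_antimono[of r s r n]
        rho.kernel_commute[of n s r] s n r by linarith
    then show "opt_prop M a (\<xi> + n) u < opt_prop M a (\<xi> + n) u'"
      using proportion_diff(1)[of s s' n u u' D] opt[of s u] opt[of s' u'] s u n \<open>s < s'\<close> r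
      by (simp add: D_def)
  qed
  have dec: "strict_antimono_on {u. v < u \<and> u < D} (opt_prop M a (\<xi> + n))"
  proof (rule monotone_onI)
    fix u u' assume "u \<in> {u. v < u \<and> u < D}" "u' \<in> {u. v < u \<and> u < D}" "u < u'"
    then have u: "v < u" "u < u'" "u' < D" "0 < u"
      using v_pos by auto
    obtain s s' where s: "1 < s" "rho.stieltjes s = D - u" "1 < s'" "rho.stieltjes s' = D - u'"
      using ex[of u] ex[of u'] u by auto
    have "r < s" "s < s'"
      using rho.stieltjes_less_iff[of s r] rho.stieltjes_less_iff[of s' s] s u v r by auto
    then have "rho.kernel n s s' < rho.kernel n r r"
      using rho.kernel_strict_antimono[of s r s' n] rho.kernel_strict_antimono[of r r s n]
        rho.kernel_commute[of n s r] s n r by linarith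
    then show "opt_prop M a (\<xi> + n) u > opt_prop M a (\<xi> + n) u'"
      using proportion_diff(2)[of s s' n u u' D] opt[of s u] opt[of s' u'] s u n \<open>s < s'\<close> r
      by (simp add: D_def)
  qed
  \<comment> \<open>Between two distinct candidates a function would have to be strictly increasing
    and strictly decreasing at once.\<close>
  have unique: False
    if "strict_antimono_on {u. w < u \<and> u < D} f" "strict_mono_on {0<..<w'} f"
      "0 < w" "w < w'" "w' < D" for w w' and f :: "real \<Rightarrow> real"
  proof -
    obtain u where "w < u" "u < w'"
      using dense[OF \<open>w < w'\<close>] by blast
    moreover obtain u' where "u < u'" "u' < w'"
      using dense[OF \<open>u < w'\<close>] by blast
    ultimately have u: "w < u" "u < u'" "u' < w'"
      by auto
    have "f u < f u'"
      using that u by (intro strict_mono_onD[OF that(2)]) auto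
    moreover have "f u' < f u"
      using that u by (intro monotone_onD[OF that(1)]) auto
    ultimately show False
      by simp
  qed
  have "u_max M a (\<xi> + n) = v"
    unfolding u_max_def dom less_ereal.simps
  proof (rule the_equality, safe)
    fix w
    assume w: "0 < w" "w < D" "strict_mono_on {0<..<w} (opt_prop M a (\<xi> + n))"
      "strict_antimono_on {u. w < u \<and> u < D} (opt_prop M a (\<xi> + n))"
    show "w = v"
      using unique[OF w(4) inc] unique[OF dec w(3)] w v_pos v_less
      by (meson linorder_neqE_linordered_idom)
  qed (fact v_pos v_less inc dec)+
  then show ?thesis
    by (simp add: v_def)
qed

section \<open>The limit as \<open>m\<close> tends to the mean\<close>

lemma tendsto_u_max:
  assumes "game_xi M a = \<xi>"
  shows "((\<lambda>m. u_max M a m / (\<xi> + L - m)) \<longlongrightarrow> 1 / 2) (at_left (\<xi> + L))"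
proof -
  let ?G = "at_left (\<xi> + L)"
  define r where "r m = (SOME r. 1 < r \<and> rho.kernel (m - \<xi>) r r = \<xi> + L - m)" for m
  have n_lim: "((\<lambda>m. m - \<xi>) \<longlongrightarrow> L) ?G"
    by (rule tendsto_eq_intros refl)+ simp
  have D_small: "\<forall>\<^sub>F m in ?G. \<xi> + L - m < y" if "0 < y" for y
    using eventually_at_left[of "\<xi> + L - 1" "\<xi> + L"] that
    by (auto intro!: exI[of _ "\<xi> + L - y"] simp: eventually_at_left_field)
  have below: "\<forall>\<^sub>F m in ?G. m < \<xi> + L"
    by (simp add: eventually_at_filter)
  have near: "\<forall>\<^sub>F m in ?G. 0 < m - \<xi> \<and> m - \<xi> < L \<and> \<xi> + L - m < rho.stieltjes 1"
    using D_small[OF L_pos] D_small[OF rho.stieltjes_pos[OF zero_less_one]]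
      below
    by eventually_elim auto
  have r: "1 < r m" "rho.kernel (m - \<xi>) (r m) (r m) = \<xi> + L - m"
    if "0 < m - \<xi> \<and> m - \<xi> < L \<and> \<xi> + L - m < rho.stieltjes 1" for m
    using someI_ex[OF rho.kernel_diag_surj[of "\<xi> + L - m" "m - \<xi>"]] that
    unfolding r_def by auto
  \<comment> \<open>The diagonal kernel dominates the transform, so the transform at
    \<open>r m\<close> is at most \<open>\<xi> + L - m\<close>, which eventually falls below any
    fixed positive value. Taking \<open>max Z 1\<close> keeps the argument positive.\<close>
  have "\<forall>\<^sub>F m in ?G. Z < r m" for Z
  proof -
    have "0 < rho.stieltjes (max Z 1)"
      by (rule rho.stieltjes_pos) simp
    from near D_small[OF this] show ?thesis
    proof eventually_elim
      case (elim m)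
      have "rho.stieltjes (r m) \<le> \<xi> + L - m"
        using rho.kernel_diag[of "r m" "m - \<xi>"] r[of m] elim rho.stieltjes_sq_pos[of "r m"]
        by (simp add: zero_le_mult_iff)
      also have "\<dots> < rho.stieltjes (max Z 1)"
        using elim by simp
      finally show ?case
        using rho.stieltjes_less_iff[of "r m" "max Z 1"] r(1)[of m] elim by simp
    qed
  qed
  then have r_top: "filterlim r at_top ?G"
    by (simp add: filterlim_at_top_dense)
  have "\<forall>\<^sub>F m in ?G. (r m + (m - \<xi>)) * rho.stieltjes_sq (r m) /
      rho.kernel (m - \<xi>) (r m) (r m) = u_max M a m / (\<xi> + L - m)"
    using near
  proof eventually_elim
    case (elim m)
    then show ?case
      using r[OF elim] u_max_eq[OF assms, of "m - \<xi>" "r m"] by simp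
  qed
  then show ?thesis
    by (rule Lim_transform_eventually[OF rho.tendsto_increment_ratio[OF r_top n_lim]])
qed

end

text \<open>The limit is stated along a pulled-back filter because the mean is an extended real; for
  a finite mean this is the ordinary left-hand limit.\<close>

lemma filtercomap_ereal_at_left: "filtercomap ereal (at_left (ereal x)) = at_left x"
proof (rule antisym)
  show "at_left x \<le> filtercomap ereal (at_left (ereal x))"
    by (simp add: at_left_ereal filtercomap_filtermap)
  show "filtercomap ereal (at_left (ereal x)) \<le> at_left x"
    unfolding le_filter_def eventually_filtercomap at_left_ereal eventually_filtermap
  proof safe
    fix P assume "eventually P (at_left x)"
    then show "\<exists>Q. (\<forall>\<^sub>F y in at_left x. Q (ereal y)) \<and> (\<forall>y. Q (ereal y) \<longrightarrow> P y)"
      by (intro exI[of _ "\<lambda>y. P (real_of_ereal y)"]) simp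
  qed
qed

section \<open>From the given game to the abstract setting\<close>

lemma prob_space_stieltjes_on:
  assumes "game I F a"
  shows "prob_space (stieltjes_on I F)"
proof -
  have "I \<in> sets borel"
    using assms by (auto simp: game_def intro: real_interval_borel_measurable)
  then show ?thesis
    using assms unfolding stieltjes_on_def game_def
    by (intro prob_space_restrict_space) auto
qed

lemma AE_game_xi_le:
  assumes "prob_space M" "a \<in> borel_measurable M" "essinf M (\<lambda>x. ereal (a x)) > - \<infinity>"
  shows "AE x in M. game_xi M a \<le> a x"
proof -
  interpret prob_space M by fact
  let ?e = "essinf M (\<lambda>x. ereal (a x))"
  have ae: "AE x in M. ?e \<le> ereal (a x)"
    using esssup_AE[of "\<lambda>x. - ereal (a x)" M] unfolding essinf_def
    by eventually_elim (simp add: ereal_uminus_le_reorder)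
  \<comment> \<open>\<open>real_of_ereal\<close> sends infinite values to 0, so
    \<open>game_xi\<close> is the essential infimum only once both infinities are excluded.\<close>
  have "?e \<noteq> \<infinity>"
  proof
    assume "?e = \<infinity>"
    with ae have "AE x in M. False"
      by simp
    then show False
      by simp
  qed
  with assms(3) obtain k where "?e = ereal k"
    by (cases ?e) auto
  with ae show ?thesis
    by (simp add: game_xi_def)
qed

text \<open>For finite \<open>\<rho>\<close> the kernel splits as
  \<open>s / (t (t + s)) = 1 / t - 1 / (t + s)\<close> with both parts integrable. The first
  contributes a constant to \<open>L\<close>, the second is the transform.\<close>

lemma associated_measure_stieltjes_game:
  fixes M \<rho> :: "real measure"
  assumes "prob_space M" "a \<in> borel_measurable M" "AE x in M. game_xi M a \<le> a x"
    and "\<And>k. \<not> (AE x in M. a x = k)"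
    and \<rho>: "associated_measure M a \<rho>" and fin: "(\<integral>\<^sup>+ t. 1 \<partial>\<rho>) < \<infinity>"
  shows "\<exists>L. stieltjes_game M \<rho> a (game_xi M a) L"
proof -
  interpret prob_space M by fact
  have sets: "sets \<rho> = sets (restrict_space borel {0<..})"
    and weight: "(\<integral>\<^sup>+ t. ennreal (1 / (t * (t + 1))) \<partial>\<rho>) < \<infinity>"
    using \<rho> unfolding associated_measure_def by blast+
  interpret rho: finite_measure \<rho>
    using fin by (intro finite_measureI) simp
  interpret rho: positive_line_measure \<rho>
    by unfold_locales (rule sets)
  have "integrable \<rho> (\<lambda>t. 1 / (t * (t + 1)))"
    using weight by (intro integrableI_nonneg rho.borel_measurable_\<rho>)
      (auto intro!: AE_I2 simp: rho.space_\<rho>)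
  \<comment> \<open>This sum is \<open>1 / t\<close>: the weight condition controls it near 0 and
    finiteness of \<open>\<rho>\<close> controls it at infinity.\<close>
  then have "integrable \<rho> (\<lambda>t. 1 / (t * (t + 1)) + 1 / (t + 1))"
    by (intro Bochner_Integration.integrable_add rho.integrable_stieltjes) auto
  also have "?this \<longleftrightarrow> integrable \<rho> (\<lambda>t. 1 / t)"
    by (intro Bochner_Integration.integrable_cong) (auto simp: rho.space_\<rho> divide_simps)
  finally have inv: "integrable \<rho> (\<lambda>t. 1 / t)" .
  let ?\<xi> = "game_xi M a"
  define L where "L = enn2real (inverse (game_H M a)) + (LINT t|\<rho>. 1 / t)"
  have "game_Psi M a (s - ?\<xi>) = ?\<xi> + L - rho.stieltjes s" if "0 < s" for s
  proof -
    have "game_Psi M a (s - ?\<xi>) = ?\<xi> + enn2real (inverse (game_H M a)) +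
        (LINT t|\<rho>. s / (t * (t + s)))"
      using \<rho>[unfolded associated_measure_def, THEN conjunct2, THEN conjunct2, rule_format,
          of "s - ?\<xi>"] that by simp
    also have "(LINT t|\<rho>. s / (t * (t + s))) = (LINT t|\<rho>. 1 / t - 1 / (t + s))"
      using that by (intro Bochner_Integration.integral_cong)
        (auto simp: rho.space_\<rho> divide_simps)
    also have "\<dots> = (LINT t|\<rho>. 1 / t) - rho.stieltjes s"
      unfolding rho.stieltjes_def using inv rho.integrable_stieltjes[OF that]
      by (rule Bochner_Integration.integral_diff)
    finally show ?thesis
      by (simp add: L_def)
  qed
  then have "stieltjes_game M \<rho> a ?\<xi> L"
    using assms(2-4) by unfold_locales
  then show ?thesis ..
qed

theorem theorem3p19:
  fixes I :: "real set" and F a :: "real \<Rightarrow> real" and M \<rho> :: "real measure" and E :: ereal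
  defines "M \<equiv> stieltjes_on I F"
  defines "E \<equiv> game_mean M a"
  assumes "game I F a"
    and "E > 0"
    and "essinf M (\<lambda>x. ereal (a x)) > - \<infinity>"
    and "associated_measure M a \<rho>"
    and "(\<integral>\<^sup>+ t. 1 \<partial>\<rho>) < \<infinity>"
  shows "((\<lambda>m. ereal (u_max M a m) / (E - ereal m)) \<longlongrightarrow> ereal (1 / 2))
           (filtercomap ereal (at_left E))"
proof -
  interpret prob_space M
    unfolding M_def using prob_space_stieltjes_on assms(3) .
  have a: "a \<in> borel_measurable M" "\<not> (AE x in M. a x = k)" for k
    using assms(3) unfolding game_def M_def by blast+
  obtain L where "stieltjes_game M \<rho> a (game_xi M a) L"
    using associated_measure_stieltjes_game[OF prob_space_axioms a(1) 
        AE_game_xi_le[OF prob_space_axioms a(1)] a(2)]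
      assms(5-7) by blast
  then interpret stieltjes_game M \<rho> a "game_xi M a" L .
  have E: "E = ereal (game_xi M a + L)"
    unfolding E_def by (rule game_mean_eq)
  have "((\<lambda>m. ereal (u_max M a m / (game_xi M a + L - m))) \<longlongrightarrow> ereal (1 / 2))
      (at_left (game_xi M a + L))"
    using tendsto_u_max[OF refl] by (rule tendsto_ereal)
  \<comment> \<open>The left filter excludes the mean itself, so the divisor is a nonzero real and
    the extended quotient is the real one.\<close>
  moreover have "\<forall>\<^sub>F m in at_left (game_xi M a + L).
      ereal (u_max M a m / (game_xi M a + L - m)) = ereal (u_max M a m) / (E - ereal m)"
    unfolding eventually_at_filter by (auto intro!: always_eventually simp: E)
  ultimately show ?thesis
    unfolding E filtercomap_ereal_at_left by (rule Lim_transform_eventually)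
qed

end
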